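(* Let $x\in\mathbb{R}^n$ and $\epsilon>0$ be such that $\|x\|>\epsilon$. Let $c^\ast$ be the optimal value and $f^\ast$ an optimal solution of the linear inverse problem: minimize $c(f)$ over $f\in\mathbb{H}$ subject to $\|x-\phi(f)\|\le\epsilon$. For any $\bar\eta,\hat\eta,\bar\epsilon>0$ such that $\bar\eta\le c^\ast<\hat\eta$ and $e(f^\ast)\le\bar\epsilon^2<\epsilon^2$, let $$B:=\frac{\epsilon\,\hat\eta^2}{(\|x\|-\epsilon)\sqrt{\epsilon^2-\bar\epsilon^2}},\qquad \alpha':=\frac{\epsilon}{\|x\|^2-\epsilon^2}\Bigl(\frac{\bar\eta}{B}\Bigr)^3,\qquad \beta':=\frac{\|x\|^2-\epsilon^2}{2\bar\eta^3}.$$ Then the mapping $\Lambda(\bar\eta,B)\ni\lambda\mapsto-2\,l(\lambda)$ is $\alpha'$-strongly convex and $\beta'$-smooth.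
   Context: $\mathbb{H}$ is a finite-dimensional real Hilbert space; $\mathbb{R}^n$ carries an inner product $\langle\cdot,\cdot\rangle$ with associated norm $\|\cdot\|$; $\phi:\mathbb{H}\to\mathbb{R}^n$ is linear. Standing assumptions. (1) The cost $c:\mathbb{H}\to\mathbb{R}$ is positively homogeneous ($c(rf)=rc(f)$ for all $r\ge0$, $f\in\mathbb{H}$), and $B_c:=\{f\in\mathbb{H}:c(f)\le1\}$ is compact and convex. (2) $\|x\|>\epsilon>0$ and there exists $f\in\mathbb{H}$ with $\|x-\phi(f)\|<\epsilon$. Definitions. $e(h):=\min_{\theta\in\mathbb{R}}\|x-\theta\phi(h)\|^2$ for $h\in\mathbb{H}$. $l(\lambda):=\sqrt{\langle\lambda,x\rangle-\epsilon\|\lambda\|}$ for $\lambda$ with $\langle\lambda,x\rangle\ge\epsilon\|\lambda\|$. $\Lambda(\bar\eta,B):=\{\lambda\in\mathbb{R}^n:\langle\lambda,x\rangle\ge\epsilon\|\lambda\|,\ l(\lambda)\ge\bar\eta,\ \|\lambda\|\le B\}$ (a convex set). A differentiable function $g$ is $\beta$-smooth on a convex set $S$ if $\|\nabla g(u)-\nabla g(v)\|\le\beta\|u-v\|$ for all $u,v\in S$, and $\alpha$-strongly convex on $S$ ($\alpha>0$) if $g(v)\ge g(u)+\langle\nabla g(u),v-u\rangle+\frac{\alpha}{2}\|v-u\|^2$ for all $u,v\in S$. *)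

theory Defs
  imports "HOL-Analysis.Analysis"
begin

text \<open>
  \<open>'a :: euclidean_space\<close> stands for \<open>\<real>\<^sup>n\<close> with an arbitrary inner product, and
  \<open>'h :: euclidean_space\<close> for the finite-dimensional real Hilbert space.
\<close>

definition feasible :: "('h::euclidean_space \<Rightarrow> 'a::euclidean_space) \<Rightarrow> 'a \<Rightarrow> real \<Rightarrow> 'h \<Rightarrow> bool" where
  "feasible \<phi> x \<epsilon> f \<longleftrightarrow> norm (x - \<phi> f) \<le> \<epsilon>"

definition optimal_value ::
  "('h::euclidean_space \<Rightarrow> real) \<Rightarrow> ('h \<Rightarrow> 'a::euclidean_space) \<Rightarrow> 'a \<Rightarrow> real \<Rightarrow> real" where
  "optimal_value c \<phi> x \<epsilon> = (INF f\<in>{f. feasible \<phi> x \<epsilon> f}. c f)"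

definition optimal_solution ::
  "('h::euclidean_space \<Rightarrow> real) \<Rightarrow> ('h \<Rightarrow> 'a::euclidean_space) \<Rightarrow> 'a \<Rightarrow> real \<Rightarrow> 'h \<Rightarrow> bool" where
  "optimal_solution c \<phi> x \<epsilon> f \<longleftrightarrow> is_arg_min c (feasible \<phi> x \<epsilon>) f"

definition proj_error ::
  "('h::euclidean_space \<Rightarrow> 'a::euclidean_space) \<Rightarrow> 'a \<Rightarrow> 'h \<Rightarrow> real" where
  "proj_error \<phi> x h = (INF \<theta>. (norm (x - \<theta> *\<^sub>R \<phi> h))\<^sup>2)"

text \<open>The infimum above is a minimum.\<close>

lemma proj_error_attained: "\<exists>\<theta>. proj_error \<phi> x h = (norm (x - \<theta> *\<^sub>R \<phi> h))\<^sup>2"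
proof -
  define p where "p = \<phi> h"
  define t where "t = (x \<bullet> p) / (p \<bullet> p)"
  have "(norm (x - t *\<^sub>R p))\<^sup>2 \<le> (norm (x - s *\<^sub>R p))\<^sup>2" for s
  proof (cases "p = 0")
    case False
    then have tp: "t * (p \<bullet> p) = x \<bullet> p" by (simp add: t_def)
    have "(norm (x - s *\<^sub>R p))\<^sup>2 - (norm (x - t *\<^sub>R p))\<^sup>2
        = (s * s - t * t) * (p \<bullet> p) - 2 * (s - t) * (x \<bullet> p)"
      by (simp add: power2_norm_eq_inner inner_diff_left inner_diff_right
          inner_commute[of p x] algebra_simps)
    also have "\<dots> = (s * s - t * t) * (p \<bullet> p) - 2 * (s - t) * (t * (p \<bullet> p))"
      by (simp only: tp)
    also have "\<dots> = (s - t)\<^sup>2 * (p \<bullet> p)"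
      by (simp add: power2_eq_square algebra_simps)
    also have "\<dots> \<ge> 0" by simp
    finally show ?thesis by simp
  qed simp
  then have "(INF s. (norm (x - s *\<^sub>R p))\<^sup>2) = (norm (x - t *\<^sub>R p))\<^sup>2"
    by (intro cInf_eq_minimum) auto
  then show ?thesis by (auto simp: proj_error_def p_def)
qed

text \<open>Only meaningful where the radicand is nonnegative, which \<open>Lam\<close> below requires.\<close>

definition ell :: "'a::euclidean_space \<Rightarrow> real \<Rightarrow> 'a \<Rightarrow> real" where
  "ell x \<epsilon> v = sqrt (v \<bullet> x - \<epsilon> * norm v)"

definition Lam :: "'a::euclidean_space \<Rightarrow> real \<Rightarrow> real \<Rightarrow> real \<Rightarrow> 'a set" where
  "Lam x \<epsilon> \<eta> B = {v. v \<bullet> x \<ge> \<epsilon> * norm v \<and> ell x \<epsilon> v \<ge> \<eta> \<and> norm v \<le> B}"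

definition gradient :: "('a::euclidean_space \<Rightarrow> real) \<Rightarrow> 'a \<Rightarrow> 'a" where
  "gradient g u = (THE D. GDERIV g u :> D)"

lemma gradient_eqI:
  assumes "GDERIV g u :> D"
  shows "gradient g u = D"
  unfolding gradient_def
proof (rule the_equality)
  show "GDERIV g u :> D" by (rule assms)
next
  fix D' assume "GDERIV g u :> D'"
  with assms have "(\<lambda>h. h \<bullet> D') = (\<lambda>h. h \<bullet> D)"
    unfolding gderiv_def by (rule has_derivative_unique[rotated])
  then show "D' = D" using vector_eq_ldot[of D' D] by (simp add: fun_eq_iff)
qed

text \<open>
  Both notions presuppose that the set is convex and that the function is differentiable,
  in the ambient space, at each of its points.
\<close>

definition beta_smooth_on :: "real \<Rightarrow> 'a::euclidean_space set \<Rightarrow> ('a \<Rightarrow> real) \<Rightarrow> bool" where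
  "beta_smooth_on \<beta> S g \<longleftrightarrow>
     convex S \<and> (\<forall>u\<in>S. g differentiable (at u)) \<and>
     (\<forall>u\<in>S. \<forall>v\<in>S. norm (gradient g u - gradient g v) \<le> \<beta> * norm (u - v))"

definition strongly_convex_on :: "real \<Rightarrow> 'a::euclidean_space set \<Rightarrow> ('a \<Rightarrow> real) \<Rightarrow> bool" where
  "strongly_convex_on \<alpha> S g \<longleftrightarrow>
     \<alpha> > 0 \<and> convex S \<and> (\<forall>u\<in>S. g differentiable (at u)) \<and>
     (\<forall>u\<in>S. \<forall>v\<in>S. g v \<ge> g u + gradient g u \<bullet> (v - u) + \<alpha> / 2 * (norm (v - u))\<^sup>2)"

end

(*
  Put l = ell x eps v, u = v / |v| and s = <u, x> - eps, so that l^2 = |v| s. The Hessian of -2 l at v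
  is (2 eps s (I - u u^T) + w w^T) / (2 l^3) with w = x - eps u. The numerator has all its eigenvalues
  in [2 eps s^3 / T, T], where T = |x|^2 - eps^2. Since l >= eta, the upper end gives beta'; since
  s / l = l / |v| >= eta / B, the lower end gives alpha'.
*)
theory Submission
  imports Defs
begin

section \<open>Second-order criteria for smoothness and strong convexity\<close>

text \<open>Turns bounds on a quadratic form into an operator norm bound without diagonalising. With
  y = A h, nonnegativity of the form at the test vector h - y/T, expanded by symmetry and bounded by
  \<open>upper\<close> at h and at y, leaves |y|^2 / T \<le> T |h|^2.\<close>

lemma selfadjoint_norm_le:
  fixes A :: "'a::real_inner \<Rightarrow> 'a"
  assumes lin: "linear A"
    and sym: "\<And>y z. A y \<bullet> z = y \<bullet> A z"
    and lower: "\<And>y. 0 \<le> A y \<bullet> y"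
    and upper: "\<And>y. A y \<bullet> y \<le> T * (norm y)\<^sup>2"
    and T: "0 < T"
  shows "norm (A h) \<le> T * norm h"
proof -
  define y where "y = A h"
  have "0 \<le> A (h - (1/T) *\<^sub>R y) \<bullet> (h - (1/T) *\<^sub>R y)"
    by (rule lower)
  also have "\<dots> = A h \<bullet> h - (2/T) * (y \<bullet> y) + (1/T)\<^sup>2 * (A y \<bullet> y)"
    using sym[of y h]
    by (simp add: linear_diff[OF lin] linear_scale[OF lin] inner_diff_left inner_diff_right
        y_def[symmetric] power2_eq_square diff_divide_distrib)
  also have "\<dots> \<le> T * (norm h)\<^sup>2 - (2/T) * (norm y)\<^sup>2 + (1/T)\<^sup>2 * (T * (norm y)\<^sup>2)"
    using upper[of h] mult_left_mono[OF upper[of y], of "(1/T)\<^sup>2"]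
    by (simp add: power2_norm_eq_inner)
  also have "\<dots> = T * (norm h)\<^sup>2 - (norm y)\<^sup>2 / T"
    using T by (simp add: field_simps power2_eq_square)
  finally have "(norm y)\<^sup>2 \<le> (T * norm h)\<^sup>2"
    using T by (simp add: field_simps power2_eq_square)
  then show ?thesis
    using T unfolding y_def by (simp add: power2_le_iff_abs_le)
qed

text \<open>Mean value inequality for the gradient map \<open>G\<close> on the convex set
  \<open>S\<close>, with the Hessian \<open>H\<close> as its derivative.\<close>

lemma beta_smooth_onI:
  assumes "convex S"
    and grad: "\<And>u. u \<in> S \<Longrightarrow> GDERIV g u :> G u"
    and hess: "\<And>u. u \<in> S \<Longrightarrow> (G has_derivative H u) (at u)"
    and bound: "\<And>u h. u \<in> S \<Longrightarrow> norm (H u h) \<le> \<beta> * norm h"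
  shows "beta_smooth_on \<beta> S g"
  unfolding beta_smooth_on_def
proof (intro conjI ballI)
  show "convex S" by fact
  show "g differentiable (at u)" if "u \<in> S" for u
    using grad[OF that] unfolding gderiv_def differentiable_def by blast
  show "norm (gradient g u - gradient g v) \<le> \<beta> * norm (u - v)" if uv: "u \<in> S" "v \<in> S" for u v
  proof -
    have "norm (G u - G v) \<le> \<beta> * norm (u - v)"
    proof (rule differentiable_bound[OF \<open>convex S\<close>])
      show "(G has_derivative H z) (at z within S)" if "z \<in> S" for z
        using hess[OF that] by (rule has_derivative_at_withinI)
      show "onorm (H z) \<le> \<beta>" if "z \<in> S" for z
        using bound[OF that] by (rule onorm_le)
    qed (use uv in auto)
    then show ?thesis
      using uv by (simp add: gradient_eqI[OF grad])
  qed
qed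

text \<open>Taylor expansion of \<open>g\<close> along the segment from u to v, with the
  second-order term in Lagrange form: the intermediate point stays in \<open>S\<close> by convexity,
  so the Hessian bound applies there.\<close>

lemma strongly_convex_onI:
  assumes "0 < \<alpha>" "convex S"
    and grad: "\<And>u. u \<in> S \<Longrightarrow> GDERIV g u :> G u"
    and hess: "\<And>u. u \<in> S \<Longrightarrow> (G has_derivative H u) (at u)"
    and bound: "\<And>u h. u \<in> S \<Longrightarrow> \<alpha> * (norm h)\<^sup>2 \<le> H u h \<bullet> h"
  shows "strongly_convex_on \<alpha> S g"
  unfolding strongly_convex_on_def
proof (intro conjI ballI)
  show "0 < \<alpha>" "convex S" by fact+
  show "g differentiable (at u)" if "u \<in> S" for u
    using grad[OF that] unfolding gderiv_def differentiable_def by blast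
  show "g u + gradient g u \<bullet> (v - u) + \<alpha> / 2 * (norm (v - u))\<^sup>2 \<le> g v"
    if uv: "u \<in> S" "v \<in> S" for u v
  proof -
    define d where "d = v - u"
    define p where "p t = u + t *\<^sub>R d" for t
    have p: "p t \<in> S" if "0 \<le> t" "t \<le> 1" for t
      using convexD_alt[OF \<open>convex S\<close> uv that]
      by (simp add: p_def d_def algebra_simps)
    have p': "(p has_derivative (\<lambda>s. s *\<^sub>R d)) (at t)" for t
      unfolding p_def by (auto intro!: derivative_eq_intros)
    \<comment> \<open>\<open>Maclaurin\<close> expects a sequence of derivatives indexed by all
      naturals. At order 2 only the indices 0, 1, 2 occur, so the value for larger m is a
      filler.\<close>
    define D where "D m = (if m = 0 then (\<lambda>t. g (p t))
      else if m = 1 then (\<lambda>t. G (p t) \<bullet> d) else (\<lambda>t. H (p t) d \<bullet> d))" for m :: nat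
    have "DERIV (D m) t :> D (Suc m) t" if "m < 2" "0 \<le> t" "t \<le> 1" for m t
    proof -
      have pt: "p t \<in> S" using p that by auto
      have "((\<lambda>t. g (p t)) has_derivative (\<lambda>s. (s *\<^sub>R d) \<bullet> G (p t))) (at t)"
        using has_derivative_compose[OF p'] grad[OF pt] unfolding gderiv_def by blast
      then have 0: "DERIV (\<lambda>t. g (p t)) t :> G (p t) \<bullet> d"
        by (simp add: has_field_derivative_def inner_commute mult.commute[of _ "inner _ _"])
      have "((\<lambda>t. G (p t)) has_derivative (\<lambda>s. H (p t) (s *\<^sub>R d))) (at t)"
        using has_derivative_compose[OF p' hess[OF pt]] .
      then have "((\<lambda>t. G (p t) \<bullet> d) has_derivative (\<lambda>s. H (p t) (s *\<^sub>R d) \<bullet> d)) (at t)"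
        by (rule has_derivative_inner_left)
      then have 1: "DERIV (\<lambda>t. G (p t) \<bullet> d) t :> H (p t) d \<bullet> d"
        by (simp add: has_field_derivative_def mult.commute[of _ "inner _ _"]
            linear_scale[OF has_derivative_linear[OF hess[OF pt]]])
      from \<open>m < 2\<close> consider "m = 0" | "m = 1" by linarith
      then show ?thesis using 0 1 by cases (simp_all add: D_def)
    qed
    then obtain t where t: "0 < t" "t < 1"
      and taylor: "g (p 1) = (\<Sum>m<2. D m 0 / fact m * 1 ^ m) + D 2 t / fact 2 * 1 ^ 2"
      using Maclaurin[of 1 2 D "\<lambda>t. g (p t)"] by (auto simp: D_def)
    have "g v = g u + G u \<bullet> d + H (p t) d \<bullet> d / 2"
      using taylor by (simp add: numeral_2_eq_2 D_def p_def d_def)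
    moreover have "\<alpha> * (norm d)\<^sup>2 \<le> H (p t) d \<bullet> d"
      using bound p t by simp
    ultimately show ?thesis
      by (simp add: gradient_eqI[OF grad[OF uv(1)]] d_def)
  qed
qed

section \<open>The gradient and the spectrum of the Hessian\<close>

text \<open>This is the gradient of -2 \<open>ell\<close>, not of \<open>ell\<close>: the factor 2
  cancels the 1/2 from differentiating the square root, and the sign turns x - \<epsilon> u into
  \<epsilon> u - x.\<close>

definition ell_grad :: "'a::euclidean_space \<Rightarrow> real \<Rightarrow> 'a \<Rightarrow> 'a" where
  "ell_grad x \<epsilon> v = (1 / ell x \<epsilon> v) *\<^sub>R (\<epsilon> *\<^sub>R sgn v - x)"

text \<open>
  The Hessian of \<open>- 2 * ell x \<epsilon>\<close> at \<open>v\<close>, scaled by \<open>2 * (ell x \<epsilon> v) ^ 3\<close>, for \<open>u = sgn v\<close>.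
\<close>

definition hess_op :: "'a::euclidean_space \<Rightarrow> real \<Rightarrow> 'a \<Rightarrow> 'a \<Rightarrow> 'a" where
  "hess_op x \<epsilon> u h = (2 * \<epsilon> * (u \<bullet> x - \<epsilon>)) *\<^sub>R (h - (u \<bullet> h) *\<^sub>R u)
     + ((x - \<epsilon> *\<^sub>R u) \<bullet> h) *\<^sub>R (x - \<epsilon> *\<^sub>R u)"

lemma linear_hess_op: "linear (hess_op x \<epsilon> u)"
  by (rule linearI) (simp_all add: hess_op_def algebra_simps inner_add_right)

lemma hess_op_sym: "hess_op x \<epsilon> u y \<bullet> z = y \<bullet> hess_op x \<epsilon> u z"
  by (simp add: hess_op_def inner_add_left inner_add_right inner_diff_left inner_diff_right
      inner_commute[of y u] inner_commute[of y x] algebra_simps)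

text \<open>
  On the span of \<open>u\<close> and the component \<open>p\<close> of \<open>x\<close> orthogonal to \<open>u\<close>, this operator has
  trace \<open>T\<close> and determinant \<open>2 * \<epsilon> * s ^ 3\<close>; the bounds say that its eigenvalues lie
  between determinant over trace and trace.
\<close>

lemma hess_op_bounds:
  fixes x u h :: "'a::euclidean_space"
  assumes u: "norm u = 1" and \<epsilon>: "0 < \<epsilon>" and pos: "0 < u \<bullet> x - \<epsilon>"
  defines "s \<equiv> u \<bullet> x - \<epsilon>" and "T \<equiv> (norm x)\<^sup>2 - \<epsilon>\<^sup>2"
  shows "2 * \<epsilon> * s ^ 3 * (norm h)\<^sup>2 \<le> T * (hess_op x \<epsilon> u h \<bullet> h)"
    and "hess_op x \<epsilon> u h \<bullet> h \<le> T * (norm h)\<^sup>2"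
proof -
  have uu: "u \<bullet> u = 1" using u by (simp add: norm_eq_1)
  \<comment> \<open>Orthogonal splittings h = a u + k and x = (u . x) u + p. With w = x - \<epsilon>
    u = s u + p they give w . h = s a + m, which reduces the form to D K^2 + (s a + m)^2.\<close>
  define a where "a = u \<bullet> h"
  define k where "k = h - a *\<^sub>R u"
  define p where "p = x - (u \<bullet> x) *\<^sub>R u"
  define m where "m = p \<bullet> k"
  define K where "K = norm k"
  define P where "P = norm p"
  define D where "D = 2 * \<epsilon> * s"
  have D: "0 < D" and s: "0 < s" using \<epsilon> pos by (simp_all add: D_def s_def)
  have K2: "K\<^sup>2 = h \<bullet> h - a\<^sup>2"
    by (simp add: K_def k_def dot_square_norm[symmetric] inner_diff_left inner_diff_right uu
        a_def inner_commute[of h u] power2_eq_square[of "inner _ _"])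
  then have h: "(norm h)\<^sup>2 = a\<^sup>2 + K\<^sup>2"
    by (simp add: power2_norm_eq_inner)
  have P2: "P\<^sup>2 = x \<bullet> x - (u \<bullet> x)\<^sup>2"
    by (simp add: P_def p_def dot_square_norm[symmetric] inner_diff_left inner_diff_right uu
        inner_commute[of x u] power2_eq_square[of "inner _ _"])
  \<comment> \<open>From |x|^2 = (s + \<epsilon>)^2 + P^2. Here D is the eigenvalue of the
    projection term and s^2 + P^2 = |w|^2 is that of the rank-one term.\<close>
  have T: "T = s\<^sup>2 + P\<^sup>2 + D"
    unfolding P2 T_def D_def s_def power2_norm_eq_inner by (simp add: power2_eq_square algebra_simps)
  have m: "\<bar>m\<bar> \<le> P * K"
    unfolding m_def P_def K_def by (rule Cauchy_Schwarz_ineq2)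
  then have m2: "m\<^sup>2 \<le> P\<^sup>2 * K\<^sup>2"
    using power_mono[OF m, of 2] by (simp add: power_mult_distrib)
  have wh: "(x - \<epsilon> *\<^sub>R u) \<bullet> h = s * a + m"
    by (simp add: m_def p_def k_def s_def inner_diff_left inner_diff_right uu a_def
        inner_commute[of x u] algebra_simps)
  have "(h - a *\<^sub>R u) \<bullet> h = K\<^sup>2"
    unfolding K2 by (simp add: inner_diff_left a_def power2_eq_square)
  then have Q: "hess_op x \<epsilon> u h \<bullet> h = D * K\<^sup>2 + (s * a + m)\<^sup>2"
    unfolding hess_op_def by (simp add: inner_add_left wh D_def s_def a_def power2_eq_square)
  define z where "z = s * a + m"
  \<comment> \<open>Cauchy-Schwarz for the plane vectors (s, P) and (|a|, K), with the defect
    written as a square by Lagrange's identity.\<close>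
  have "(s * a + m)\<^sup>2 \<le> (s\<^sup>2 + P\<^sup>2) * (a\<^sup>2 + K\<^sup>2)"
  proof -
    have "(s * a + m)\<^sup>2 \<le> (s * \<bar>a\<bar> + P * K)\<^sup>2"
      by (rule abs_le_square_iff[THEN iffD1])
        (use m s abs_triangle_ineq[of "s * a" m] in \<open>simp add: abs_mult P_def K_def\<close>)
    also have "\<dots> = (s\<^sup>2 + P\<^sup>2) * (a\<^sup>2 + K\<^sup>2) - (s * K - P * \<bar>a\<bar>)\<^sup>2"
      by (simp add: power2_eq_square algebra_simps)
    also have "\<dots> \<le> (s\<^sup>2 + P\<^sup>2) * (a\<^sup>2 + K\<^sup>2)" by simp
    finally show ?thesis .
  qed
  moreover have "D * K\<^sup>2 \<le> D * (a\<^sup>2 + K\<^sup>2)" using D by simp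
  ultimately show "hess_op x \<epsilon> u h \<bullet> h \<le> T * (norm h)\<^sup>2"
    unfolding Q h T by (simp add: algebra_simps)
  \<comment> \<open>The cross term of the identity below has no fixed sign. Both signs are
    controlled by |m| \<le> P K, and then by the arithmetic-geometric mean inequality for P |z| and
    D K.\<close>
  have "2 * (D * m * z) \<le> 2 * (P * \<bar>z\<bar>) * (D * K)"
  proof -
    have "D * m * z \<le> D * \<bar>z\<bar> * \<bar>m\<bar>"
      using D abs_ge_self[of "D * m * z"] by (simp add: abs_mult mult_ac)
    also have "\<dots> \<le> D * \<bar>z\<bar> * (P * K)" using D m by (intro mult_left_mono) auto
    finally show ?thesis by (simp add: mult_ac)
  qed
  moreover have "- (2 * (D * m * z)) \<le> 2 * (P * \<bar>z\<bar>) * (D * K)"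
  proof -
    have "- (D * m * z) \<le> D * \<bar>z\<bar> * \<bar>m\<bar>"
      using D abs_ge_minus_self[of "D * m * z"] by (simp add: abs_mult mult_ac)
    also have "\<dots> \<le> D * \<bar>z\<bar> * (P * K)" using D m by (intro mult_left_mono) auto
    finally show ?thesis by (simp add: mult_ac)
  qed
  moreover have "2 * (P * \<bar>z\<bar>) * (D * K) \<le> P\<^sup>2 * z\<^sup>2 + D\<^sup>2 * K\<^sup>2"
    using sum_squares_bound[of "P * \<bar>z\<bar>" "D * K"] by (simp add: power_mult_distrib)
  moreover have "D * m\<^sup>2 \<le> D * (P\<^sup>2 * K\<^sup>2)" using m2 D by simp
  moreover have "0 \<le> s\<^sup>2 * z\<^sup>2" by simp
  \<comment> \<open>Substituting s a = z - m in D s^2 a^2 cancels D z^2, and D s^2 K^2 cancels as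
    well. The remaining groups are nonnegative once the cross term is absorbed into P^2 z^2 + D^2
    K^2.\<close>
  moreover have "T * (D * K\<^sup>2 + z\<^sup>2) - D * s\<^sup>2 * (a\<^sup>2 + K\<^sup>2)
      = (D * (P\<^sup>2 * K\<^sup>2) - D * m\<^sup>2) + s\<^sup>2 * z\<^sup>2 + (P\<^sup>2 * z\<^sup>2 + D\<^sup>2 * K\<^sup>2) + 2 * (D * m * z)"
    unfolding T z_def by (simp add: power2_eq_square algebra_simps)
  ultimately have "D * s\<^sup>2 * (a\<^sup>2 + K\<^sup>2) \<le> T * (D * K\<^sup>2 + z\<^sup>2)" by linarith
  then show "2 * \<epsilon> * s ^ 3 * (norm h)\<^sup>2 \<le> T * (hess_op x \<epsilon> u h \<bullet> h)"
    unfolding Q h z_def by (simp add: D_def power2_eq_square power3_eq_cube mult_ac)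
qed

section \<open>First and second derivatives of -2 \<open>ell\<close>\<close>

lemma GDERIV_ell:
  assumes v: "v \<noteq> 0" and pos: "0 < v \<bullet> x - \<epsilon> * norm v"
  shows "GDERIV (\<lambda>v. - 2 * ell x \<epsilon> v) v :> ell_grad x \<epsilon> v"
proof -
  have norm': "(norm has_derivative (\<lambda>h. h \<bullet> sgn v)) (at v)"
    using GDERIV_norm[OF v] by (simp add: gderiv_def)
  have "((\<lambda>v. v \<bullet> x - \<epsilon> * norm v) has_derivative (\<lambda>h. h \<bullet> x - \<epsilon> * (h \<bullet> sgn v))) (at v)"
    by (intro has_derivative_diff has_derivative_inner_left has_derivative_ident
        has_derivative_mult_right norm')
  from has_derivative_mult_right[OF has_derivative_real_sqrt[OF pos this], of "- 2"]
  show ?thesis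
    unfolding gderiv_def ell_def
  proof (rule has_derivative_eq_rhs, intro ext)
    fix h
    define A where "A = h \<bullet> x - \<epsilon> * (h \<bullet> sgn v)"
    have "h \<bullet> ell_grad x \<epsilon> v = - A / sqrt (v \<bullet> x - \<epsilon> * norm v)"
      by (simp add: ell_grad_def ell_def A_def inner_diff_right)
    then show "- 2 * ((h \<bullet> x - \<epsilon> * (h \<bullet> sgn v)) * (inverse (sqrt (v \<bullet> x - \<epsilon> * norm v)) / 2))
        = h \<bullet> ell_grad x \<epsilon> v"
      unfolding A_def[symmetric] by (simp add: inverse_eq_divide)
  qed
qed

text \<open>Product rule for 1/l times \<epsilon> u - x: differentiating u = \<open>sgn v\<close>
  yields the projection term of \<open>hess_op\<close>, differentiating 1/l the rank-one
  term.\<close>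

lemma has_derivative_ell_grad:
  assumes v: "v \<noteq> 0" and pos: "0 < v \<bullet> x - \<epsilon> * norm v"
  shows "(ell_grad x \<epsilon> has_derivative
    (\<lambda>h. (1 / (2 * ell x \<epsilon> v ^ 3)) *\<^sub>R hess_op x \<epsilon> (sgn v) h)) (at v)"
proof -
  define u where "u = sgn v"
  define l where "l = ell x \<epsilon> v"
  have l: "0 < l" and l2: "l\<^sup>2 = norm v * (u \<bullet> x - \<epsilon>)"
    using pos v by (simp_all add: l_def ell_def u_def sgn_div_norm algebra_simps)
  have "((\<lambda>v. - 2 * ell x \<epsilon> v) has_derivative (\<lambda>h. h \<bullet> ell_grad x \<epsilon> v)) (at v)"
    using GDERIV_ell[OF v pos] by (simp add: gderiv_def)
  \<comment> \<open>The derivative of \<open>ell\<close> itself is recovered by rescaling that of -2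
    \<open>ell\<close>.\<close>
  from has_derivative_mult_right[OF this, of "- 1 / 2"]
  have ell': "(ell x \<epsilon> has_derivative (\<lambda>h. ((x - \<epsilon> *\<^sub>R u) \<bullet> h) / (2 * l))) (at v)"
    by (simp add: ell_grad_def u_def[symmetric] l_def[symmetric] inner_commute inner_diff_right
        diff_divide_distrib mult.commute[of l])
  have norm': "(norm has_derivative (\<lambda>h. h \<bullet> u)) (at v)"
    using GDERIV_norm[OF v] by (simp add: gderiv_def u_def)
  have nu: "norm v *\<^sub>R u = v" using v by (simp add: u_def sgn_div_norm)
  \<comment> \<open>Differentiates v / |v|. Replacing v by |v| u in the radial term leaves the
    projection onto the complement of u, divided by |v|.\<close>
  have "((\<lambda>w. inverse (norm w) *\<^sub>R w) has_derivative
      (\<lambda>h. inverse (norm v) *\<^sub>R h + (- (inverse (norm v) * (h \<bullet> u) * inverse (norm v))) *\<^sub>R v)) (at v)"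
    using has_derivative_scaleR[OF Deriv.has_derivative_inverse[OF _ norm'] has_derivative_ident] v
    by simp
  then have sgn': "(sgn has_derivative (\<lambda>h. (1 / norm v) *\<^sub>R (h - (u \<bullet> h) *\<^sub>R u))) (at v)"
    unfolding sgn_div_norm
  proof (rule has_derivative_eq_rhs, intro ext)
    fix h
    have "(inverse (norm v) * (h \<bullet> u) * inverse (norm v)) *\<^sub>R v
        = (inverse (norm v) * (h \<bullet> u) * inverse (norm v)) *\<^sub>R (norm v *\<^sub>R u)"
      by (simp only: nu)
    also have "\<dots> = (1 / norm v) *\<^sub>R ((u \<bullet> h) *\<^sub>R u)"
      using v by (simp add: inner_commute[of h u] inverse_eq_divide)
    finally show "inverse (norm v) *\<^sub>R h + (- (inverse (norm v) * (h \<bullet> u) * inverse (norm v))) *\<^sub>R v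
        = (1 / norm v) *\<^sub>R (h - (u \<bullet> h) *\<^sub>R u)"
      by (simp add: inverse_eq_divide scaleR_diff_right)
  qed
  define w where "w = x - \<epsilon> *\<^sub>R u"
  then have w: "\<epsilon> *\<^sub>R u - x = - w" by simp
  have "((\<lambda>z. inverse (ell x \<epsilon> z) *\<^sub>R (\<epsilon> *\<^sub>R sgn z - x)) has_derivative
    (\<lambda>h. inverse l *\<^sub>R (\<epsilon> *\<^sub>R ((1 / norm v) *\<^sub>R (h - (u \<bullet> h) *\<^sub>R u)) - 0)
       + (- (inverse l * ((w \<bullet> h) / (2 * l)) * inverse l)) *\<^sub>R (\<epsilon> *\<^sub>R u - x))) (at v)"
    using has_derivative_scaleR[OF Deriv.has_derivative_inverse[OF _ ell']
        has_derivative_diff[OF has_derivative_scaleR_right[OF sgn'] has_derivative_const]] l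
    by (simp only: l_def[symmetric] u_def[symmetric] w_def)
  then have "(ell_grad x \<epsilon> has_derivative
    (\<lambda>h. (\<epsilon> / (l * norm v)) *\<^sub>R (h - (u \<bullet> h) *\<^sub>R u) + ((w \<bullet> h) / (2 * l ^ 3)) *\<^sub>R w)) (at v)"
    unfolding ell_grad_def
    by (simp add: inverse_eq_divide w power3_eq_cube mult_ac)
  \<comment> \<open>By l^2 = |v| s the denominator l |v| equals l^3 / s, which gives both terms the
    common factor 1 / (2 l^3).\<close>
  moreover have "\<epsilon> / (l * norm v) = (2 * \<epsilon> * (u \<bullet> x - \<epsilon>)) / (2 * l ^ 3)"
  proof -
    define t where "t = u \<bullet> x - \<epsilon>"
    have "l ^ 3 = l * norm v * t"
      using l2 by (simp add: power2_eq_square power3_eq_cube t_def)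
    then show ?thesis using l v unfolding t_def[symmetric] by auto
  qed
  ultimately show ?thesis
    by (simp add: hess_op_def u_def[symmetric] l_def[symmetric] w_def[symmetric] scaleR_add_right)
qed

section \<open>Convexity of the domain\<close>

text \<open>For positive \<eta> the two conditions involving \<open>ell\<close> amount to \<eta>^2
  \<le> v . x - \<epsilon> |v|, a superlevel set of a concave function; the norm bound intersects it
  with a ball.\<close>

lemma convex_Lam:
  assumes \<epsilon>: "0 \<le> \<epsilon>" and \<eta>: "0 < \<eta>"
  shows "convex (Lam x \<epsilon> \<eta> B)"
proof -
  have eq: "Lam x \<epsilon> \<eta> B = {v. \<eta>\<^sup>2 \<le> v \<bullet> x - \<epsilon> * norm v} \<inter> cball 0 B"
  proof -
    have "\<eta>\<^sup>2 \<le> q \<longleftrightarrow> 0 \<le> q \<and> \<eta> \<le> sqrt q" for q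
    proof
      show "0 \<le> q \<and> \<eta> \<le> sqrt q" if "\<eta>\<^sup>2 \<le> q"
        using that order_trans[OF zero_le_power2 that] by (simp add: real_le_rsqrt)
      show "\<eta>\<^sup>2 \<le> q" if "0 \<le> q \<and> \<eta> \<le> sqrt q"
        using that power_mono[of \<eta> "sqrt q" 2] \<eta> by simp
    qed
    then show ?thesis by (auto simp: Lam_def ell_def)
  qed
  have "convex {v. \<eta>\<^sup>2 \<le> v \<bullet> x - \<epsilon> * norm v}"
  proof (rule convexI, clarsimp)
    fix u v :: 'a and a b :: real
    assume u: "\<eta>\<^sup>2 \<le> u \<bullet> x - \<epsilon> * norm u" and v: "\<eta>\<^sup>2 \<le> v \<bullet> x - \<epsilon> * norm v"
      and ab: "0 \<le> a" "0 \<le> b" "a + b = 1"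
    have "\<eta>\<^sup>2 = a * \<eta>\<^sup>2 + b * \<eta>\<^sup>2"
      using ab by (simp flip: distrib_right)
    also have "\<dots> \<le> a * (u \<bullet> x - \<epsilon> * norm u) + b * (v \<bullet> x - \<epsilon> * norm v)"
      using u v ab by (intro add_mono mult_left_mono)
    also have "\<dots> = (a *\<^sub>R u + b *\<^sub>R v) \<bullet> x - \<epsilon> * (norm (a *\<^sub>R u) + norm (b *\<^sub>R v))"
      using ab by (simp add: inner_add_left algebra_simps)
    also have "\<dots> \<le> (a *\<^sub>R u + b *\<^sub>R v) \<bullet> x - \<epsilon> * norm (a *\<^sub>R u + b *\<^sub>R v)"
      using mult_left_mono[OF norm_triangle_ineq[of "a *\<^sub>R u" "b *\<^sub>R v"] \<epsilon>] by simp
    finally show "\<eta>\<^sup>2 \<le> (a *\<^sub>R u + b *\<^sub>R v) \<bullet> x - \<epsilon> * norm (a *\<^sub>R u + b *\<^sub>R v)" .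
  qed
  then show ?thesis
    unfolding eq by (intro convex_Int convex_cball)
qed

section \<open>Uniform Hessian bounds over \<open>Lam\<close>\<close>

theorem lemma2p16:
  fixes \<phi> :: "'h::euclidean_space \<Rightarrow> 'a::euclidean_space"
    and c :: "'h \<Rightarrow> real"
    and x :: 'a
    and fstar :: 'h
    and \<epsilon> cstar eta_bar eta_hat eps_bar B \<alpha>' \<beta>' :: real
  assumes "linear \<phi>"
    and "\<And>r f. r \<ge> 0 \<Longrightarrow> c (r *\<^sub>R f) = r * c f"
    and "compact {f. c f \<le> 1}"
    and "convex {f. c f \<le> 1}"
    and "\<epsilon> > 0"
    and "norm x > \<epsilon>"
    and "\<exists>f. norm (x - \<phi> f) < \<epsilon>"
    and "cstar = optimal_value c \<phi> x \<epsilon>"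
    and "optimal_solution c \<phi> x \<epsilon> fstar"
    and "eta_bar > 0" and "eta_hat > 0" and "eps_bar > 0"
    and "eta_bar \<le> cstar" and "cstar < eta_hat"
    and "proj_error \<phi> x fstar \<le> eps_bar\<^sup>2" and "eps_bar\<^sup>2 < \<epsilon>\<^sup>2"
    and "B = \<epsilon> * eta_hat\<^sup>2 / ((norm x - \<epsilon>) * sqrt (\<epsilon>\<^sup>2 - eps_bar\<^sup>2))"
    and "\<alpha>' = \<epsilon> / ((norm x)\<^sup>2 - \<epsilon>\<^sup>2) * (eta_bar / B) ^ 3"
    and "\<beta>' = ((norm x)\<^sup>2 - \<epsilon>\<^sup>2) / (2 * eta_bar ^ 3)"
  shows "strongly_convex_on \<alpha>' (Lam x \<epsilon> eta_bar B) (\<lambda>v. - 2 * ell x \<epsilon> v)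
       \<and> beta_smooth_on \<beta>' (Lam x \<epsilon> eta_bar B) (\<lambda>v. - 2 * ell x \<epsilon> v)"
proof -
  note \<epsilon> = \<open>\<epsilon> > 0\<close> and \<eta> = \<open>eta_bar > 0\<close>
  define S where "S = Lam x \<epsilon> eta_bar B"
  define T where "T = (norm x)\<^sup>2 - \<epsilon>\<^sup>2"
  define H where "H v h = (1 / (2 * ell x \<epsilon> v ^ 3)) *\<^sub>R hess_op x \<epsilon> (sgn v) h" for v h
  have T: "T > 0"
    using \<open>norm x > \<epsilon>\<close> \<epsilon> by (simp add: T_def power_strict_mono)
  have B: "B > 0"
    using assms by simp
  have \<alpha>: "\<alpha>' = \<epsilon> / T * (eta_bar / B) ^ 3" and \<beta>: "\<beta>' = T / (2 * eta_bar ^ 3)"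
    using assms by (simp_all add: T_def)
  \<comment> \<open>Since \<open>eta_bar\<close> is positive, the radicand is strictly positive on
    \<open>S\<close>. This keeps v away from 0, where the norm has a kink, and away from the zeros
    of \<open>ell\<close>, so both derivatives exist.\<close>
  have S: "v \<noteq> 0" "v \<bullet> x - \<epsilon> * norm v > 0" "eta_bar \<le> ell x \<epsilon> v" "norm v \<le> B"
      "norm (sgn v) = 1" "sgn v \<bullet> x - \<epsilon> > 0" "(ell x \<epsilon> v)\<^sup>2 = norm v * (sgn v \<bullet> x - \<epsilon>)"
    if "v \<in> S" for v
  proof -
    show l: "eta_bar \<le> ell x \<epsilon> v" and "norm v \<le> B"
      using that by (auto simp: S_def Lam_def)
    then have "sqrt (v \<bullet> x - \<epsilon> * norm v) > 0"
      using \<eta> unfolding ell_def by linarith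
    then show q: "v \<bullet> x - \<epsilon> * norm v > 0" by simp
    then show v: "v \<noteq> 0" by auto
    then show "norm (sgn v) = 1" by (simp add: norm_sgn)
    have eq: "v \<bullet> x - \<epsilon> * norm v = norm v * (sgn v \<bullet> x - \<epsilon>)"
      using v by (simp add: sgn_div_norm algebra_simps)
    show "sgn v \<bullet> x - \<epsilon> > 0"
      using q v unfolding eq by (simp add: zero_less_mult_iff)
    show "(ell x \<epsilon> v)\<^sup>2 = norm v * (sgn v \<bullet> x - \<epsilon>)"
      using q by (simp add: ell_def eq)
  qed
  have conv: "convex S"
    unfolding S_def using \<epsilon> \<eta> by (intro convex_Lam) simp_all
  have grad: "GDERIV (\<lambda>v. - 2 * ell x \<epsilon> v) v :> ell_grad x \<epsilon> v" if "v \<in> S" for v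
    using S(1,2)[OF that] by (rule GDERIV_ell)
  have hess: "(ell_grad x \<epsilon> has_derivative H v) (at v)" if "v \<in> S" for v
    using has_derivative_ell_grad[OF S(1,2)[OF that]] by (simp add: H_def[abs_def])
  have "norm (H v h) \<le> \<beta>' * norm h" if v: "v \<in> S" for v h
  proof -
    note bounds = hess_op_bounds[OF S(5)[OF v] \<epsilon> S(6)[OF v], folded T_def]
    have "norm (hess_op x \<epsilon> (sgn v) h) \<le> T * norm h"
    proof (rule selfadjoint_norm_le[OF linear_hess_op hess_op_sym _ bounds(2) T])
      fix y :: 'a
      \<comment> \<open>Positive semidefiniteness comes from the lower spectral bound after
        cancelling T.\<close>
      have "0 \<le> 2 * \<epsilon> * (sgn v \<bullet> x - \<epsilon>) ^ 3 * (norm y)\<^sup>2"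
        using \<epsilon> S(6)[OF v] by simp
      then have "0 \<le> T * (hess_op x \<epsilon> (sgn v) y \<bullet> y)"
        using bounds(1) by (rule order_trans)
      then show "0 \<le> hess_op x \<epsilon> (sgn v) y \<bullet> y"
        using T by (simp add: zero_le_mult_iff)
    qed
    then have "norm (H v h) \<le> T * norm h / (2 * ell x \<epsilon> v ^ 3)"
      using S(3)[OF v] \<eta> by (simp add: H_def divide_right_mono)
    also have "\<dots> \<le> T * norm h / (2 * eta_bar ^ 3)"
      using S(3)[OF v] \<eta> T by (intro divide_left_mono mult_left_mono power_mono) auto
    finally show ?thesis by (simp add: \<beta>)
  qed
  then have smooth: "beta_smooth_on \<beta>' S (\<lambda>v. - 2 * ell x \<epsilon> v)"
    by (intro beta_smooth_onI[OF conv grad hess])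
  have "\<alpha>' * (norm h)\<^sup>2 \<le> H v h \<bullet> h" if v: "v \<in> S" for v h
  proof -
    define l where "l = ell x \<epsilon> v"
    define s where "s = sgn v \<bullet> x - \<epsilon>"
    have l: "0 < l" "eta_bar \<le> l" and l2: "l\<^sup>2 = norm v * s" and v0: "0 < norm v"
      using S[OF v] \<eta> by (simp_all add: l_def s_def)
    \<comment> \<open>Dividing the lower bound 2 \<epsilon> s^3 / T by 2 l^3 leaves \<epsilon> / T
      times (s / l)^3. In the form l / |v| this ratio is bounded below by the constraints of
      \<open>Lam\<close>.\<close>
    have sl: "s / l = l / norm v"
      using l v0 l2 by (simp add: field_simps power2_eq_square)
    have "0 \<le> eta_bar / B"
      using \<eta> B by simp
    moreover have "eta_bar / B \<le> l / norm v"
      using l v0 S(4)[OF v] by (simp add: frac_le)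
    ultimately have "\<alpha>' * (norm h)\<^sup>2 \<le> \<epsilon> / T * (l / norm v) ^ 3 * (norm h)\<^sup>2"
      unfolding \<alpha> using \<epsilon> T by (intro mult_right_mono mult_left_mono power_mono) auto
    also have "\<dots> = 2 * \<epsilon> * s ^ 3 * (norm h)\<^sup>2 / T / (2 * l ^ 3)"
      unfolding sl[symmetric] by (simp add: power_divide)
    also have "\<dots> \<le> T * (hess_op x \<epsilon> (sgn v) h \<bullet> h) / T / (2 * l ^ 3)"
      using hess_op_bounds(1)[OF S(5)[OF v] \<epsilon> S(6)[OF v], folded T_def s_def] T l
      by (intro divide_right_mono) auto
    also have "\<dots> = H v h \<bullet> h"
      using T by (simp add: H_def l_def)
    finally show ?thesis .
  qed
  moreover have "\<alpha>' > 0"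
    unfolding \<alpha> using \<epsilon> T \<eta> B by simp
  ultimately have "strongly_convex_on \<alpha>' S (\<lambda>v. - 2 * ell x \<epsilon> v)"
    by (intro strongly_convex_onI[OF _ conv grad hess])
  with smooth show ?thesis
    unfolding S_def by blast
qed

end
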